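(* Let $k$ be a nonnegative integer. (1) Every 3-uniform hypergraph $H$ on $n\ge 4k+19$ vertices with $\delta_1(H)\ge kn+6k^2-3k+3$ contains a linear path of length $2k+1$. (2) Every 3-uniform hypergraph $H$ on $n\ge 4k+21$ vertices with $\delta_1(H)\ge kn+6k^2+7k+6$ contains a linear path of length $2k+2$.
   Context: All hypergraphs are simple (no repeated edges). A 3-uniform hypergraph (3-graph) $H=(V,E)$ has edges that are 3-element subsets of $V$. For $v\in V$, $d_H(v)$ is the number of edges containing $v$, and $\delta_1(H)=\min_{v\in V}d_H(v)$. A linear path of length $k$ is a collection of $k$ edges $e_1,\dots,e_k$ such that $|e_i\cap e_j|=1$ if $|i-j|=1$ and $e_i\cap e_j=\emptyset$ otherwise. *)

theory Defs
  imports Main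
begin

text \<open>Vertex sets are taken to be finite.  Edges form a set of sets, so there are
  no repeated edges.\<close>

definition three_graph :: "'a set \<Rightarrow> 'a set set \<Rightarrow> bool" where
  "three_graph V E \<longleftrightarrow> finite V \<and> (\<forall>e\<in>E. e \<subseteq> V \<and> card e = 3)"

definition degree :: "'a set set \<Rightarrow> 'a \<Rightarrow> nat" where
  "degree E v = card {e \<in> E. v \<in> e}"

text \<open>Meaningful only for finite nonempty \<^term>\<open>V\<close>, because of \<^const>\<open>Min\<close>.\<close>

definition min_degree :: "'a set \<Rightarrow> 'a set set \<Rightarrow> nat" where
  "min_degree V E = Min (degree E ` V)"

definition linear_path :: "'a set list \<Rightarrow> bool" where
  "linear_path es \<longleftrightarrow>
     (\<forall>i<length es. \<forall>j<length es. i \<noteq> j \<longrightarrow>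
        (if \<bar>int i - int j\<bar> = 1 then card (es ! i \<inter> es ! j) = 1
         else es ! i \<inter> es ! j = {}))"

text \<open>The length of a linear path is its number of edges.  Listing the edges loses
  nothing: in a 3-graph the intersection conditions force them to be distinct.\<close>

definition contains_linear_path :: "'a set set \<Rightarrow> nat \<Rightarrow> bool" where
  "contains_linear_path E l \<longleftrightarrow> (\<exists>es. set es \<subseteq> E \<and> length es = l \<and> linear_path es)"

end

(* A path is rotated as in Posa's lemma, and a longest path is chosen with as many fat edges as
   possible, an edge being fat if its two joints have many common edges with vertices outside the
   path, so that its third vertex is exchangeable; the core of the path consists of its vertices
   other than these exchangeable ones. By maximality no edge joins an end of the path to two
   vertices outside the core, so the degree condition makes each end rich (large codegree outside
   the core) with more than k core vertices. A joint rich with an end must close off a fat edge,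
   since otherwise the rotation there would create a new fat edge. As the third vertex of a fat
   edge is not in the core, every edge of the path carries at most one vertex rich with a given
   end, and since there are at most 2k+1 edges, some edge serves both ends. If that edge is not
   fat, both ends are joined through its third vertex to a longer path. If it is fat, the two rich
   pairs close up a linear cycle with one edge more than the path; by maximality all its edges are
   fat. Then a vertex exchangeable into the cycle lies only in edges with two joints of the cycle,
   so its degree is too small. *)

theory Submission
  imports Defs
begin

section \<open>Consecutive pairs of a list\<close>

fun pairs :: "'a list \<Rightarrow> 'a set set" where
  "pairs (x # y # zs) = insert {x, y} (pairs (y # zs))"
| "pairs zs = {}"

lemma pairs_Cons: "zs \<noteq> [] \<Longrightarrow> pairs (x # zs) = insert {x, hd zs} (pairs zs)"
  by (cases zs) auto

lemma pairs_append:
  "xs \<noteq> [] \<Longrightarrow> ys \<noteq> [] \<Longrightarrow>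
    pairs (xs @ ys) = insert {last xs, hd ys} (pairs xs \<union> pairs ys)"
proof (induction xs)
  case (Cons x xs)
  then show ?case by (cases "xs = []") (auto simp: pairs_Cons)
qed simp

lemma pairs_rev [simp]: "pairs (rev xs) = pairs xs"
proof (induction xs)
  case (Cons x xs)
  then show ?case
    by (cases "xs = []") (auto simp: pairs_Cons pairs_append last_rev insert_commute)
qed simp

lemma pairs_subset: "e \<in> pairs xs \<Longrightarrow> e \<subseteq> set xs"
  by (induction xs rule: pairs.induct) auto

lemma finite_pairs [simp]: "finite (pairs xs)"
  by (induction xs rule: pairs.induct) auto

lemma card_pairs: "distinct xs \<Longrightarrow> card (pairs xs) = length xs - 1"
proof (induction xs rule: pairs.induct)
  case (1 x y zs)
  have "{x, y} \<notin> pairs (y # zs)"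
    using 1(2) pairs_subset[of "{x, y}" "y # zs"] by auto
  then show ?case using 1 by simp
qed auto

lemma pairs_nth: "pairs xs = {{xs ! i, xs ! Suc i} | i. Suc i < length xs}"
proof (induction xs rule: pairs.induct)
  case (1 x y zs)
  have "{{(x # y # zs) ! i, (x # y # zs) ! Suc i} | i. Suc i < length (x # y # zs)}
      = insert {x, y} {{(y # zs) ! i, (y # zs) ! Suc i} | i. Suc i < length (y # zs)}"
    (is "?L = ?R")
  proof (intro equalityI subsetI)
    fix e assume "e \<in> ?L"
    then obtain i where "Suc i < length (x # y # zs)" "e = {(x # y # zs) ! i, (x # y # zs) ! Suc i}"
      by auto
    then show "e \<in> ?R" by (cases i) auto
  next
    fix e assume "e \<in> ?R"
    then consider "e = {x, y}"
      | i where "Suc i < length (y # zs)" "e = {(y # zs) ! i, (y # zs) ! Suc i}" by auto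
    then show "e \<in> ?L"
    proof cases
      case 1 then show ?thesis by (intro CollectI exI[of _ 0]) auto
    next
      case (2 i) then show ?thesis by (intro CollectI exI[of _ "Suc i"]) auto
    qed
  qed
  then show ?case using 1 by simp
qed auto

lemma pairs_split:
  assumes "e \<in> pairs c"
  obtains xs ys where "c = xs @ ys" "xs \<noteq> []" "ys \<noteq> []" "e = {last xs, hd ys}"
proof -
  obtain i where i: "Suc i < length c" "e = {c ! i, c ! Suc i}"
    using assms by (auto simp: pairs_nth)
  have "take (Suc i) c \<noteq> []" "drop (Suc i) c \<noteq> []" using i by auto
  moreover have "last (take (Suc i) c) = c ! i" using i by (simp add: take_Suc_conv_app_nth)
  moreover have "hd (drop (Suc i) c) = c ! Suc i" using i by (simp add: hd_drop_conv_nth)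
  ultimately show ?thesis using i that[of "take (Suc i) c" "drop (Suc i) c"] by auto
qed

text \<open>A pair meeting both of two disjoint pieces lies inside neither. In a rotation this shows
  that an inserted link is new and a removed one is really gone.\<close>

lemma pair_split_notin:
  assumes "distinct (xs @ ys)" "xs \<noteq> []" "ys \<noteq> []" "a \<in> set xs" "b \<in> set ys"
  shows "{a, b} \<notin> pairs xs \<union> pairs ys"
  using assms pairs_subset[of "{a, b}" xs] pairs_subset[of "{a, b}" ys] by auto

section \<open>Linear paths encoded by joints and third vertices\<close>

text \<open>A linear path is encoded by the list of its joints, with one end vertex of the first and of
  the last edge counted as joints, and by a choice of the third vertex of each edge.  Indexing the
  latter by unordered pairs of consecutive joints makes it invariant under rotations of the path.\<close>

definition expansion :: "'a set set \<Rightarrow> 'a list \<Rightarrow> ('a set \<Rightarrow> 'a) \<Rightarrow> bool" where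
  "expansion E c m \<longleftrightarrow> distinct c \<and> inj_on m (pairs c) \<and> m ` pairs c \<inter> set c = {} \<and>
    (\<forall>e\<in>pairs c. insert (m e) e \<in> E)"

text \<open>Joints are distinct, third vertices are distinct, and no third vertex is a joint; so two
  edges can share only a joint common to consecutive pairs.\<close>

lemma expansion_linear_path:
  assumes "expansion E c m" "length c = Suc l"
  shows "contains_linear_path E l"
proof -
  define e where "e i = {c ! i, c ! Suc i}" for i
  define es where "es = map (\<lambda>i. insert (m (e i)) (e i)) [0..<l]"
  have dist: "distinct c" and inj: "inj_on m (pairs c)" and disj: "m ` pairs c \<inter> set c = {}"
    and mE: "\<And>p. p \<in> pairs c \<Longrightarrow> insert (m p) p \<in> E"
    using assms by (auto simp: expansion_def)
  have ep: "e i \<in> pairs c" if "i < l" for i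
    using that assms(2) by (auto simp: pairs_nth e_def)
  have ce: "c ! i = c ! j \<longleftrightarrow> i = j" if "i \<le> l" "j \<le> l" for i j
    using that assms(2) dist by (simp add: nth_eq_iff_index_eq)
  have mc: "m (e i) \<noteq> c ! j" if "i < l" "j \<le> l" for i j
    using disj ep[OF that(1)] that assms(2) nth_mem[of j c] by fastforce
  have mm: "m (e i) \<noteq> m (e j)" if "i < l" "j < l" "i \<noteq> j" for i j
  proof
    assume "m (e i) = m (e j)"
    then have "e i = e j" using inj ep that by (auto dest: inj_onD)
    \<comment> \<open>Equality of unordered pairs also allows the crossed matching, which would give
      both \<open>i = Suc j\<close> and \<open>j = Suc i\<close>.\<close>
    then have "c ! i = c ! j \<or> c ! i = c ! Suc j \<and> c ! Suc i = c ! j"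
      unfolding e_def doubleton_eq_iff by auto
    then show False using that ce[of i j] ce[of i "Suc j"] ce[of "Suc i" j] by auto
  qed
  have es: "es ! i = {m (e i), c ! i, c ! Suc i}" if "i < l" for i
    using that by (simp add: es_def e_def)
  have succ: "es ! i \<inter> es ! Suc i = {c ! Suc i}" if "Suc i < l" for i
    using that by (auto simp: es ce mc mm mc[symmetric])
  have far: "es ! i \<inter> es ! j = {}" if "Suc i < j" "j < l" for i j
    using that by (auto simp: es ce mc mm mc[symmetric])
  have "linear_path es"
    unfolding linear_path_def
  proof (intro allI impI)
    fix i j assume ij: "i < length es" "j < length es" "i \<noteq> j"
    then have l: "i < l" "j < l" by (auto simp: es_def)
    consider "j = Suc i" | "i = Suc j" | "Suc i < j" | "Suc j < i" using ij by linarith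
    then show "if \<bar>int i - int j\<bar> = 1 then card (es ! i \<inter> es ! j) = 1 else es ! i \<inter> es ! j = {}"
    proof cases
      case 1 then show ?thesis using succ[of i] l by simp
    next
      case 2 then show ?thesis using succ[of j] l by (simp add: Int_commute)
    next
      case 3 then show ?thesis using far[of i j] l by auto
    next
      case 4 then show ?thesis using far[of j i] l by (auto simp: Int_commute)
    qed
  qed
  moreover have "set es \<subseteq> E" using ep mE by (auto simp: es_def)
  moreover have "length es = l" by (simp add: es_def)
  ultimately show ?thesis unfolding contains_linear_path_def by blast
qed

section \<open>Distinct representatives avoiding given vertices\<close>

text \<open>A system of distinct representatives of the sets \<open>N e\<close> that can be made to
  avoid any \<open>r\<close> elements; the choice may depend on \<open>X\<close>.\<close>

definition robust :: "nat \<Rightarrow> ('b \<Rightarrow> 'a set) \<Rightarrow> 'b set \<Rightarrow> bool" where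
  "robust r N F \<longleftrightarrow> (\<forall>X. finite X \<and> card X \<le> r \<longrightarrow>
     (\<exists>\<mu>. inj_on \<mu> F \<and> (\<forall>e\<in>F. \<mu> e \<in> N e - X)))"

lemma robust_mono:
  assumes "robust r N F" "F' \<subseteq> F" "\<And>e. e \<in> F' \<Longrightarrow> N e \<subseteq> N' e" "r' \<le> r"
  shows "robust r' N' F'"
  unfolding robust_def
proof (intro allI impI)
  fix X :: "'b set" assume "finite X \<and> card X \<le> r'"
  then obtain \<mu> where "inj_on \<mu> F" "\<forall>e\<in>F. \<mu> e \<in> N e - X"
    using assms(1,4) unfolding robust_def by (meson le_trans)
  then show "\<exists>\<mu>. inj_on \<mu> F' \<and> (\<forall>e\<in>F'. \<mu> e \<in> N' e - X)"
    using assms(2,3) by (intro exI[of _ \<mu>]) (auto intro: inj_on_subset)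
qed

text \<open>Greedy choice: the old representatives and the forbidden elements block at most
  \<open>card F + r\<close> members of \<open>N e\<close>.\<close>

lemma robust_insert:
  assumes "robust r N F" "finite F" "card F + r < card (N e)"
  shows "robust r N (insert e F)"
proof (cases "e \<in> F")
  case True then show ?thesis using assms(1) by (simp add: insert_absorb)
next
  case False
  show ?thesis
    unfolding robust_def
  proof (intro allI impI)
    fix X :: "'b set" assume X: "finite X \<and> card X \<le> r"
    then obtain \<mu> where \<mu>: "inj_on \<mu> F" "\<forall>e\<in>F. \<mu> e \<in> N e - X"
      using assms(1) unfolding robust_def by blast
    have "card (\<mu> ` F \<union> X) \<le> card F + r"
      using X card_Un_le[of "\<mu> ` F" X] card_image_le[OF assms(2), of \<mu>] by linarith
    then have "\<not> N e \<subseteq> \<mu> ` F \<union> X"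
      using assms(2,3) X card_mono[of "\<mu> ` F \<union> X" "N e"] by fastforce
    then obtain u where "u \<in> N e" "u \<notin> \<mu> ` F" "u \<notin> X" by blast
    then show "\<exists>\<mu>. inj_on \<mu> (insert e F) \<and> (\<forall>f\<in>insert e F. \<mu> f \<in> N f - X)"
      using \<mu> False
      by (intro exI[of _ "\<mu>(e := u)"]) (auto simp: inj_on_def)
  qed
qed


section \<open>Lengthening and shortening at the first joint\<close>

lemma expansion_Cons:
  assumes "expansion E c \<mu>" "c \<noteq> []" "x \<notin> set c \<union> \<mu> ` pairs c" "w \<notin> set c \<union> \<mu> ` pairs c"
    "x \<noteq> w" "{w, x, hd c} \<in> E"
  shows "expansion E (x # c) (\<mu>({x, hd c} := w))"
proof -
  \<comment> \<open>As \<open>x\<close> is not yet a joint, its pair is new, and the update leaves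
    the old third vertices alone.\<close>
  have "{x, hd c} \<notin> pairs c" using assms(3) pairs_subset by fastforce
  then have *: "(\<mu>({x, hd c} := w)) e = \<mu> e" if "e \<in> pairs c" for e using that by auto
  then have "inj_on (\<mu>({x, hd c} := w)) (pairs c)"
    using assms(1) by (auto simp: expansion_def inj_on_def)
  then show ?thesis
    using assms * \<open>{x, hd c} \<notin> pairs c\<close>
    unfolding expansion_def pairs_Cons[OF assms(2)]
    by (auto simp: inj_on_insert image_iff)
qed

lemma expansion_tl: "expansion E c \<mu> \<Longrightarrow> expansion E (tl c) \<mu>"
proof (cases c rule: pairs.cases)
  case (1 x y zs)
  assume "expansion E c \<mu>"
  then show ?thesis unfolding 1 expansion_def by (auto simp: inj_on_def)
qed (auto simp: expansion_def)

section \<open>Good paths and their fat pairs\<close>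

locale hypergraph3 =
  fixes V :: "'a set" and E :: "'a set set"
  assumes three_graph: "three_graph V E"
begin

lemma finite_V: "finite V" and edge_subset: "e \<in> E \<Longrightarrow> e \<subseteq> V" and edge_card: "e \<in> E \<Longrightarrow> card e = 3"
  using three_graph by (auto simp: three_graph_def)

lemma edge_distinct: "{a, b, d} \<in> E \<Longrightarrow> a \<noteq> b \<and> a \<noteq> d \<and> b \<noteq> d"
  using edge_card[of "{a, b, d}"] by (auto simp: card_insert_if split: if_splits)

definition core :: "'a list \<Rightarrow> 'a set set \<Rightarrow> ('a set \<Rightarrow> 'a) \<Rightarrow> 'a set" where
  "core c F m = set c \<union> m ` (pairs c - F)"

definition free :: "'a list \<Rightarrow> 'a set set \<Rightarrow> ('a set \<Rightarrow> 'a) \<Rightarrow> 'a set" where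
  "free c F m = V - core c F m"

definition nbrs :: "'a set \<Rightarrow> 'a set \<Rightarrow> 'a set" where
  "nbrs W e = {u \<in> W. insert u e \<in> E}"

text \<open>The pairs in \<open>F\<close> are the fat ones: the third vertices of their edges are not
  fixed but can be chosen simultaneously outside any prescribed set of \<open>r\<close> vertices.\<close>

definition good :: "nat \<Rightarrow> 'a list \<Rightarrow> 'a set set \<Rightarrow> ('a set \<Rightarrow> 'a) \<Rightarrow> bool" where
  "good r c F m \<longleftrightarrow> distinct c \<and> set c \<subseteq> V \<and> F \<subseteq> pairs c \<and> inj_on m (pairs c - F) \<and>
     m ` (pairs c - F) \<inter> set c = {} \<and> (\<forall>e\<in>pairs c - F. insert (m e) e \<in> E) \<and>
     robust r (nbrs (free c F m)) F"

lemma nbrs_subset: "nbrs W e \<subseteq> W"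
  by (auto simp: nbrs_def)

lemma core_subset: "good r c F m \<Longrightarrow> core c F m \<subseteq> V"
proof -
  assume good: "good r c F m"
  have "m e \<in> V" if "e \<in> pairs c - F" for e
    using edge_subset[of "insert (m e) e"] good that by (simp add: good_def)
  then show ?thesis using good by (auto simp: core_def good_def)
qed

lemma finite_core [simp]: "finite (core c F m)"
  by (simp add: core_def)

lemma finite_free [simp]: "finite (free c F m)"
  using finite_V by (simp add: free_def)

lemma good_finite: "good r c F m \<Longrightarrow> finite F"
  by (meson good_def finite_pairs finite_subset)

lemma good_rev: "good r c F m \<Longrightarrow> good r (rev c) F m"
  by (simp add: good_def free_def core_def)

lemma core_rev [simp]: "core (rev c) F m = core c F m"
  by (simp add: core_def)

lemma free_rev [simp]: "free (rev c) F m = free c F m"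
  by (simp add: free_def)

lemma good_empty: "expansion E c m \<Longrightarrow> set c \<subseteq> V \<Longrightarrow> good r c {} m"
  by (auto simp: good_def expansion_def robust_def)

text \<open>A path with \<open>l\<close> edges has \<open>2 * l + 1\<close> vertices, and each fat
  pair takes its third vertex out of the count.\<close>

lemma card_core:
  assumes "good r c F m" "length c = Suc l"
  shows "card (core c F m) = Suc (2 * l) - card F" "card F \<le> l"
proof -
  have "card (pairs c) = l" "card (set c) = Suc l"
    using assms card_pairs[of c] by (auto simp: good_def distinct_card)
  moreover have "card (pairs c - F) = card (pairs c) - card F"
    using assms good_finite by (intro card_Diff_subset) (auto simp: good_def)
  moreover show "card F \<le> l"
    using assms calculation(1) by (metis card_mono finite_pairs good_def)
  moreover have "card (core c F m) = card (set c) + card (m ` (pairs c - F))"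
    unfolding core_def using assms by (intro card_Un_disjoint) (auto simp: good_def)
  moreover have "card (m ` (pairs c - F)) = card (pairs c - F)"
    using assms by (intro card_image) (auto simp: good_def)
  ultimately show "card (core c F m) = Suc (2 * l) - card F" by simp
qed

text \<open>Representatives of fat pairs are free, hence outside the core, so they collide neither
  with joints nor with the third vertices fixed by \<open>m\<close>. This turns a good path into an
  actual linear path.\<close>

lemma good_expansion:
  assumes "good r c F m" "finite X" "card X \<le> r"
  obtains \<mu> where "expansion E c \<mu>" "\<And>e. e \<in> F \<Longrightarrow> \<mu> e \<in> free c F m - X"
    "\<And>e. e \<in> pairs c - F \<Longrightarrow> \<mu> e = m e"
proof -
  obtain \<nu> where \<nu>: "inj_on \<nu> F" "\<And>e. e \<in> F \<Longrightarrow> \<nu> e \<in> nbrs (free c F m) e - X"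
  proof -
    have "robust r (nbrs (free c F m)) F" using assms(1) by (simp add: good_def)
    then have "\<exists>\<nu>. inj_on \<nu> F \<and> (\<forall>e\<in>F. \<nu> e \<in> nbrs (free c F m) e - X)"
      using assms(2,3) by (simp add: robust_def)
    then show ?thesis using that by auto
  qed
  define \<mu> where "\<mu> e = (if e \<in> F then \<nu> e else m e)" for e
  have F: "\<mu> e \<in> free c F m - X" "insert (\<mu> e) e \<in> E" if "e \<in> F" for e
    using \<nu>(2)[OF that] that by (auto simp: \<mu>_def nbrs_def)
  have G: "\<mu> e = m e" if "e \<in> pairs c - F" for e using that by (auto simp: \<mu>_def)
  have "inj_on \<mu> (pairs c)"
  proof (rule inj_onI)
    fix e e' assume e: "e \<in> pairs c" "e' \<in> pairs c" "\<mu> e = \<mu> e'"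
    have core: "m e \<in> core c F m" if "e \<in> pairs c - F" for e using that by (auto simp: core_def)
    have inj: "inj_on m (pairs c - F)" using assms(1) by (simp add: good_def)
    have free: "\<mu> e \<notin> core c F m" if "e \<in> F" for e using F(1)[OF that] by (simp add: free_def)
    consider "e \<in> F" "e' \<in> F" | "e \<notin> F" "e' \<notin> F" | "e \<in> F \<longleftrightarrow> e' \<notin> F" by blast
    then show "e = e'"
    proof cases
      case 1
      then show ?thesis using e(3) \<nu>(1) by (simp add: \<mu>_def inj_on_eq_iff)
    next
      case 2
      then show ?thesis using e G inj by (simp add: inj_on_eq_iff)
    next
      case 3
      then show ?thesis using e core[of e] core[of e'] free[of e] free[of e'] G[of e] G[of e']
        by (metis DiffI)
    qed
  qed
  moreover have "insert (\<mu> e) e \<in> E" if "e \<in> pairs c" for e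
    using that F(2) G assms(1) by (cases "e \<in> F") (auto simp: good_def)
  moreover have "\<mu> e \<notin> set c" if "e \<in> pairs c" for e
    using that F(1)[of e] G[of e] assms(1) by (cases "e \<in> F") (auto simp: good_def free_def core_def)
  moreover have "distinct c" using assms(1) by (simp add: good_def)
  ultimately have "expansion E c \<mu>" by (auto simp: expansion_def)
  then show ?thesis using F(1) G by (rule that)
qed

text \<open>The new core lies in the old one, so the free set can only grow. Hence robustness need
  only be checked against the free set of the old path.\<close>

lemma good_reroute:
  assumes "good r c F m" "distinct c'" "set c' \<subseteq> core c F m" "F' \<subseteq> pairs c'"
    "pairs c' - F' \<subseteq> pairs c - F" "m ` (pairs c' - F') \<inter> set c' = {}"
    "robust r' (nbrs (free c F m)) F'"
  shows "good r' c' F' m"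
proof -
  have "core c' F' m \<subseteq> core c F m" using assms(3,5) by (auto simp: core_def)
  then have "robust r' (nbrs (free c' F' m)) F'"
    by (intro robust_mono[OF assms(7)]) (auto simp: free_def nbrs_def)
  moreover have "inj_on m (pairs c' - F')"
    using assms(1,5) by (auto simp: good_def intro: inj_on_subset)
  moreover have "set c' \<subseteq> V" using assms(1,3) core_subset by blast
  moreover have "insert (m e) e \<in> E" if "e \<in> pairs c' - F'" for e
    using that assms(1,5) by (auto simp: good_def)
  ultimately show ?thesis
    unfolding good_def using assms(2,4,6) by (intro conjI ballI)
qed

lemma good_reroute_joints:
  assumes "good r c F m" "distinct c'" "set c' \<subseteq> set c" "F' \<subseteq> pairs c'"
    "pairs c' - F' \<subseteq> pairs c - F" "robust r' (nbrs (free c F m)) F'"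
  shows "good r' c' F' m"
proof (rule good_reroute[OF assms(1,2)])
  show "set c' \<subseteq> core c F m" using assms(3) by (auto simp: core_def)
  have "m ` (pairs c' - F') \<inter> set c' \<subseteq> m ` (pairs c - F) \<inter> set c"
    by (rule Int_mono[OF image_mono[OF assms(5)] assms(3)])
  also have "\<dots> = {}" using assms(1) by (simp add: good_def)
  finally show "m ` (pairs c' - F') \<inter> set c' = {}" by simp
qed (fact assms)+

end

section \<open>Longest paths with the most fat pairs\<close>

text \<open>Here \<open>l\<close> is the length of a longest linear path and \<open>f\<close> is the maximal number
  of fat pairs among the paths of this length.\<close>

locale saturated = hypergraph3 +
  fixes l f :: nat
  assumes l_pos: "l \<ge> 1"
    and no_longer: "expansion E c m \<Longrightarrow> length c \<noteq> Suc (Suc l)"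
    and max_fat: "good 2 c F m \<Longrightarrow> length c = Suc l \<Longrightarrow> card F \<le> f"
begin

text \<open>Such an edge could be attached at the first joint: the reserve of 2 lets the fat edges
  stay away from both \<open>u\<close> and \<open>w\<close>.\<close>

lemma no_free_edge_hd:
  assumes "good 2 c F m" "length c = Suc l" "u \<in> free c F m" "w \<in> free c F m"
  shows "{w, u, hd c} \<notin> E"
proof
  assume E: "{w, u, hd c} \<in> E"
  have c: "c \<noteq> []" using assms(2) by auto
  have "card {u, w} \<le> 2" by (simp add: card_insert_if)
  then obtain \<mu> where \<mu>: "expansion E c \<mu>" "\<And>e. e \<in> F \<Longrightarrow> \<mu> e \<in> free c F m - {u, w}"
      "\<And>e. e \<in> pairs c - F \<Longrightarrow> \<mu> e = m e"
    using good_expansion[OF assms(1), of "{u, w}"] by blast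
  have "x \<notin> set c \<union> \<mu> ` pairs c" if "x \<in> {u, w}" for x
  proof -
    have "x \<in> free c F m" using that assms by auto
    then have "x \<notin> core c F m" by (simp add: free_def)
    then show ?thesis using \<mu>(2,3) that by (auto simp: core_def)
  qed
  then have "expansion E (u # c) (\<mu>({u, hd c} := w))"
    using E edge_distinct[OF E] by (intro expansion_Cons[OF \<mu>(1) c]) auto
  from no_longer[OF this] show False using assms(2) by simp
qed

text \<open>Taking \<open>u\<close> as third vertex of the first edge releases \<open>m e\<close>,
  which then extends the path through \<open>{w, c ! 0, m e}\<close>. This gives the saving in the
  case without fat pairs.\<close>

lemma no_two_edges_hd:
  assumes "good 2 c F m" "length c = Suc l" "e = {c ! 0, c ! 1}" "e \<notin> F"
    "u \<in> free c F m" "w \<in> free c F m" "u \<noteq> w"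
    "{u, c ! 0, c ! 1} \<in> E" "{w, c ! 0, m e} \<in> E"
  shows False
proof -
  obtain a b cs where c: "c = a # b # cs"
    using assms(2) l_pos by (cases c rule: pairs.cases) auto
  have e: "e = {a, b}" "e \<in> pairs c - F" using assms(3,4) c by auto
  have "card {u, w} \<le> 2" by (simp add: card_insert_if)
  then obtain \<mu> where \<mu>: "expansion E c \<mu>" "\<And>e. e \<in> F \<Longrightarrow> \<mu> e \<in> free c F m - {u, w}"
      "\<And>e. e \<in> pairs c - F \<Longrightarrow> \<mu> e = m e"
    using good_expansion[OF assms(1), of "{u, w}"] by blast
  have avoid: "x \<notin> set c \<union> \<mu> ` pairs c" if "x \<in> {u, w}" for x
  proof -
    have "x \<in> free c F m" using that assms by auto
    then have "x \<notin> core c F m" by (simp add: free_def)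
    then show ?thesis using \<mu>(2,3) that by (auto simp: core_def)
  qed
  have me: "\<mu> e = m e" using \<mu>(3) e by auto
  have exp: "distinct c" "inj_on \<mu> (pairs c)" "\<mu> ` pairs c \<inter> set c = {}"
    using \<mu>(1) by (auto simp: expansion_def)
  have ab: "{a, b} \<notin> pairs (b # cs)"
    using exp(1) pairs_subset[of "{a, b}" "b # cs"] c by auto
  \<comment> \<open>The first joint is removed and put back, so that its edge receives the third
    vertex \<open>u\<close>.\<close>
  have 1: "expansion E (b # cs) \<mu>" using expansion_tl[OF \<mu>(1)] c by simp
  have 2: "expansion E (a # b # cs) (\<mu>({a, b} := u))"
    using expansion_Cons[OF 1, of a u] exp avoid[of u] assms(8) c by auto
  have me': "m e \<notin> set c" "m e \<notin> \<mu> ` pairs (b # cs)"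
    using me e exp ab c by (auto simp: inj_on_def image_iff)
  have img: "(\<mu>({a, b} := u)) ` pairs (a # b # cs) \<subseteq> insert u (\<mu> ` pairs (b # cs))" by auto
  have "m e \<in> \<mu> ` pairs c" using me e by (metis DiffD1 image_eqI)
  then have "m e \<noteq> u" "m e \<noteq> w" using avoid[of u] avoid[of w] by auto
  then have "expansion E (m e # a # b # cs) ((\<mu>({a, b} := u))({m e, a} := w))"
    using expansion_Cons[OF 2, of "m e" w] me' avoid[of w] assms(7,9) c img
    by (auto simp: insert_commute)
  from no_longer[OF this] show False using assms(2) c by simp
qed

text \<open>Rotation: reversing \<open>xs\<close> replaces the link \<open>{last xs, hd ys}\<close>
  by \<open>{hd xs, hd ys}\<close>. With codegree \<open>f + 3\<close> the new link could be made
  fat, and no fat pair is lost, as the removed link is not fat.\<close>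

lemma nonfat_joint:
  assumes "good 2 (xs @ ys) F m" "length (xs @ ys) = Suc l" "xs \<noteq> []" "ys \<noteq> []"
    "{last xs, hd ys} \<notin> F" "card F = f"
  shows "card (nbrs (free (xs @ ys) F m) {hd xs, hd ys}) < f + 3"
proof (rule ccontr)
  let ?N = "nbrs (free (xs @ ys) F m)" and ?e = "{hd xs, hd ys}"
  assume "\<not> card (?N ?e) < f + 3"
  then have "robust 2 ?N (insert ?e F)"
    using assms good_finite[OF assms(1)] by (intro robust_insert) (auto simp: good_def)
  moreover have P: "pairs (rev xs @ ys) = insert ?e (pairs xs \<union> pairs ys)"
    using assms(3,4) by (simp add: pairs_append last_rev)
  moreover have F: "F \<subseteq> pairs xs \<union> pairs ys"
    using assms by (auto simp: good_def pairs_append)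
  ultimately have "good 2 (rev xs @ ys) (insert ?e F) m"
    using assms by (intro good_reroute_joints[OF assms(1)]) (auto simp: good_def pairs_append)
  then have "card (insert ?e F) \<le> f" using max_fat assms(2) by simp
  moreover have "?e \<notin> F"
    using F pair_split_notin[of xs ys "hd xs" "hd ys"] assms by (auto simp: good_def)
  ultimately show False using assms(6) good_finite[OF assms(1)] by simp
qed

text \<open>Running from \<open>last xs\<close> back to \<open>hd xs\<close>, through
  \<open>z\<close> as a new joint, and from \<open>last ys\<close> back to \<open>hd ys\<close>
  gives a path with one edge more.\<close>

lemma nonfat_meeting:
  assumes "good 2 (xs @ ys) F m" "length (xs @ ys) = Suc l" "xs \<noteq> []" "ys \<noteq> []"
    "{last xs, hd ys} \<notin> F" "card F = f" "z = m {last xs, hd ys}"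
    "card (nbrs (free (xs @ ys) F m) {hd xs, z}) \<ge> f + 3"
    "card (nbrs (free (xs @ ys) F m) {last ys, z}) \<ge> f + 3"
  shows False
proof -
  let ?c = "xs @ ys" and ?d = "rev xs @ z # rev ys"
  let ?N = "nbrs (free ?c F m)"
  let ?e = "{last xs, hd ys}" and ?a = "{hd xs, z}" and ?b = "{last ys, z}"
  have fin: "finite F" using good_finite[OF assms(1)] .
  have eP: "?e \<in> pairs ?c - F" using assms by (simp add: pairs_append)
  have z: "z \<notin> set ?c" "z \<in> core ?c F m"
    using assms(1,7) eP by (auto simp: good_def core_def)
  have P: "pairs ?d = insert ?a (insert ?b (pairs xs \<union> pairs ys))"
    using assms(3,4) by (auto simp: pairs_append pairs_Cons last_rev hd_rev insert_commute)
  have F: "F \<subseteq> pairs xs \<union> pairs ys" using assms by (auto simp: good_def pairs_append)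
  \<comment> \<open>Two pairs are to be made fat, so the reserve is lowered to 1: at the second
    insertion at most \<open>f + 1\<close> pairs are fat, and
    \<open>f + 1 + 1 < f + 3\<close>.\<close>
  have "robust 1 ?N F" using assms(1) by (auto simp: good_def intro: robust_mono)
  then have "robust 1 ?N (insert ?a F)" using assms(6,8) fin by (intro robust_insert) auto
  moreover have "card (insert ?a F) \<le> f + 1" using card_insert_le_m1 assms(6) fin
    by (simp add: card_insert_if)
  ultimately have rob: "robust 1 ?N (insert ?b (insert ?a F))"
    using assms(9) fin by (intro robust_insert[of 1 _ "insert ?a F"]) auto
  have sub: "pairs ?d - insert ?b (insert ?a F) \<subseteq> pairs ?c - F - {?e}"
    using P pair_split_notin[of xs ys "last xs" "hd ys"] assms(1,3,4)
    by (auto simp: pairs_append good_def)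
  \<comment> \<open>\<open>S\<close> holds the third vertices of the other nonfat pairs; injectivity
    of \<open>m\<close> keeps \<open>z\<close> out of it, so \<open>z\<close> may become a
    joint.\<close>
  define S where "S = m ` (pairs ?c - F - {?e})"
  have inj: "inj_on m (pairs ?c - F)" and disj: "m ` (pairs ?c - F) \<inter> set ?c = {}"
    using assms(1) by (simp_all add: good_def)
  have "z \<notin> S"
    using inj_on_image_set_diff[OF inj, of "pairs ?c - F" "{?e}"] eP assms(7) by (auto simp: S_def)
  moreover have "S \<inter> set ?c = {}"
    using Int_mono[of S "m ` (pairs ?c - F)" "set ?c" "set ?c"] disj unfolding S_def by blast
  moreover have "set ?d = insert z (set ?c)" by auto
  ultimately have "S \<inter> set ?d = {}" by simp
  moreover have "m ` (pairs ?d - insert ?b (insert ?a F)) \<subseteq> S"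
    unfolding S_def by (rule image_mono[OF sub])
  ultimately have disj: "m ` (pairs ?d - insert ?b (insert ?a F)) \<inter> set ?d = {}"
    by (meson disjoint_iff subset_iff)
  have "good 1 ?d (insert ?b (insert ?a F)) m"
  proof (rule good_reroute[OF assms(1)])
    show "distinct ?d" using assms(1) z(1) by (auto simp: good_def)
    show "set ?d \<subseteq> core ?c F m" using z(2) by (auto simp: core_def)
    show "insert ?b (insert ?a F) \<subseteq> pairs ?d" using F P by auto
    show "pairs ?d - insert ?b (insert ?a F) \<subseteq> pairs ?c - F" using sub by auto
  qed (fact disj, fact rob)
  then obtain \<mu> where "expansion E ?d \<mu>"
    by (rule good_expansion[of 1 _ _ _ "{}"]) auto
  from no_longer[OF this] show False using assms(2) by simp
qed

text \<open>Giving up the fat link makes room for two new pairs: before the second insertion there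
  are at most \<open>f\<close> fat pairs, so codegree \<open>f + 3\<close> suffices with the reserve
  still 2.\<close>

lemma fat_cycle_robust:
  assumes "good 2 (xs @ ys) F m" "{last xs, hd ys} \<in> F" "card F = f"
    "card (nbrs (free (xs @ ys) F m) {hd xs, hd ys}) \<ge> f + 3"
    "card (nbrs (free (xs @ ys) F m) {last ys, last xs}) \<ge> f + 3"
  shows "robust 2 (nbrs (free (xs @ ys) F m))
    (insert {hd xs, hd ys} (insert {last xs, last ys} (F - {{last xs, hd ys}})))"
proof -
  let ?N = "nbrs (free (xs @ ys) F m)" and ?F = "F - {{last xs, hd ys}}"
  have fin: "finite ?F" using good_finite[OF assms(1)] by simp
  have card: "card ?F < f" using assms(2,3) good_finite[OF assms(1)] by (metis card_Diff1_less)
  have "robust 2 ?N ?F" using assms(1) by (auto simp: good_def intro: robust_mono)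
  then have *: "robust 2 ?N (insert {last xs, last ys} ?F)"
    using card fin assms(5) by (intro robust_insert[of 2 _ ?F]) (auto simp: insert_commute)
  have "card (insert {last xs, last ys} ?F) \<le> f" using card fin by (simp add: card_insert_if)
  then show ?thesis
    using * fin assms(4) by (intro robust_insert[of 2 _ "insert {last xs, last ys} ?F"]) auto
qed

text \<open>The pairs of \<open>xs @ rev ys\<close> and the link \<open>{hd xs, hd ys}\<close> form
  a cycle through all joints. Opening it at a nonfat pair would leave a path of the same length with
  \<open>f + 1\<close> fat pairs.\<close>

lemma fat_cycle_all_fat:
  assumes "good 2 (xs @ ys) F m" "length (xs @ ys) = Suc l" "xs \<noteq> []" "ys \<noteq> []"
    "{last xs, hd ys} \<in> F" "card F = f"
    "card (nbrs (free (xs @ ys) F m) {hd xs, hd ys}) \<ge> f + 3"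
    "card (nbrs (free (xs @ ys) F m) {last ys, last xs}) \<ge> f + 3"
  shows "F = pairs (xs @ ys)"
proof (rule ccontr)
  let ?c = "xs @ ys" and ?d = "xs @ rev ys"
  let ?e = "{last xs, hd ys}" and ?a = "{hd xs, hd ys}" and ?b = "{last xs, last ys}"
  let ?P = "pairs xs \<union> pairs ys"
  let ?F = "insert ?a (insert ?b (F - {?e}))"
  have dist: "distinct ?c" and FP: "F \<subseteq> pairs ?c" using assms(1) by (auto simp: good_def)
  have Pc: "pairs ?c = insert ?e ?P" using assms(3,4) by (simp add: pairs_append)
  have Pd: "pairs ?d = insert ?b ?P" using assms(3,4) by (simp add: pairs_append hd_rev)
  have e: "?e \<notin> ?P" and a: "?a \<notin> ?P" and b: "?b \<notin> ?P"
    using dist assms(3,4) by (intro pair_split_notin; simp)+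
  assume "F \<noteq> pairs ?c"
  then obtain s where s: "s \<in> pairs ?c" "s \<notin> F" using FP by auto
  then have sP: "s \<in> ?P" using assms(5) Pc by auto
  then have "s \<in> pairs ?d" using Pd by auto
  \<comment> \<open>The cycle is opened at \<open>s\<close>; the pieces in the order
    \<open>bs @ as\<close> are joined by the closing link \<open>?a\<close>.\<close>
  then obtain as bs where d: "?d = as @ bs" "as \<noteq> []" "bs \<noteq> []" "s = {last as, hd bs}"
    by (rule pairs_split)
  have distd: "distinct (as @ bs)" using dist by (simp flip: d(1))
  have "hd as = hd xs" using d assms(3) by (metis hd_append2)
  moreover have "last bs = hd ys" using d assms(4) by (metis last_appendR last_rev rev_is_Nil_conv)
  ultimately have "pairs (bs @ as) = insert ?a (pairs as \<union> pairs bs)"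
    using d by (auto simp: pairs_append insert_commute)
  moreover have "pairs as \<union> pairs bs = pairs ?d - {s}"
    using pair_split_notin[OF distd d(2,3), of "last as" "hd bs"] d by (auto simp: pairs_append)
  ultimately have P': "pairs (bs @ as) = insert ?a (insert ?b ?P - {s})" using Pd by simp
  have F0: "F - {?e} \<subseteq> ?P - {s}" using FP Pc s by auto
  have setd: "set (bs @ as) = set ?c"
  proof -
    have "set (bs @ as) = set (as @ bs)" by auto
    then show ?thesis by (simp flip: d(1))
  qed
  have "good 2 (bs @ as) ?F m"
  proof (rule good_reroute_joints[OF assms(1)])
    show "distinct (bs @ as)" using distd by auto
    show "?F \<subseteq> pairs (bs @ as)" unfolding P' using F0 b sP by auto
    show "pairs (bs @ as) - ?F \<subseteq> pairs ?c - F" unfolding P' Pc using e by auto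
    show "robust 2 (nbrs (free ?c F m)) ?F"
      using fat_cycle_robust[OF assms(1,5,6,7,8)] .
  qed (use setd in simp)
  moreover have "length (bs @ as) = Suc l"
    using assms(2) arg_cong[OF d(1), of length] by simp
  ultimately have le: "card ?F \<le> f" by (rule max_fat)
  \<comment> \<open>The two new links coincide only if \<open>xs\<close> and \<open>ys\<close> are
    singletons, and then \<open>?P\<close> is empty and cannot contain \<open>s\<close>.\<close>
  have "?a \<noteq> ?b"
  proof
    assume "?a = ?b"
    moreover have "hd xs \<noteq> last ys"
      using dist assms(3,4) by (metis disjoint_iff distinct_append hd_in_set last_in_set)
    ultimately have "hd xs = last xs" "hd ys = last ys"
      by (auto simp: doubleton_eq_iff)
    then have "length xs = 1" "length ys = 1"
      using dist assms(3,4) by (cases xs; cases ys; auto simp: last_ConsR split: if_splits)+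
    then show False using sP by (auto simp: length_Suc_conv)
  qed
  moreover have "?a \<notin> F - {?e}" "?b \<notin> F - {?e}" using a b F0 by blast+
  ultimately have "card ?F = Suc (Suc (card (F - {?e})))"
    using good_finite[OF assms(1)] by (simp only: card_insert_disjoint finite_insert
      finite_Diff insert_iff simp_thms)
  moreover have "Suc (card (F - {?e})) = f"
    using assms(5,6) good_finite[OF assms(1)] by (metis card_Suc_Diff1)
  ultimately show False using le by simp
qed

text \<open>With all pairs fat, the core is just the set of joints. An edge at a vertex
  \<open>u\<close> exchangeable into the cycle has both other vertices among the
  \<open>Suc l\<close> joints, since otherwise it would lengthen a path obtained by opening the
  cycle.\<close>

lemma fat_cycle_small_degree:
  assumes "good 2 (xs @ ys) F m" "length (xs @ ys) = Suc l" "xs \<noteq> []" "ys \<noteq> []"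
    "card F = f"
    "card (nbrs (free (xs @ ys) F m) {hd xs, hd ys}) \<ge> f + 3"
    "card (nbrs (free (xs @ ys) F m) {last ys, last xs}) \<ge> f + 3"
    "F = pairs (xs @ ys)"
  obtains u where "u \<in> V" "degree E u \<le> Suc l choose 2"
proof -
  let ?c = "xs @ ys" let ?J = "set ?c" let ?U = "V - ?J"
  let ?d = "xs @ rev ys"
  let ?a = "{hd xs, hd ys}" and ?b = "{last xs, last ys}" and ?e = "{last xs, hd ys}"
  let ?P = "pairs xs \<union> pairs ys"
  have dist: "distinct ?c" and JV: "?J \<subseteq> V" using assms(1) by (auto simp: good_def)
  have free: "free ?c F m = ?U" using assms(8) by (auto simp: free_def core_def)
  have Pc: "pairs ?c = insert ?e ?P" using assms(3,4) by (simp add: pairs_append)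
  have Pd: "pairs ?d = insert ?b ?P" using assms(3,4) by (simp add: pairs_append hd_rev)
  have e: "?e \<notin> ?P" using dist assms(3,4) by (intro pair_split_notin) auto
  \<comment> \<open>\<open>C\<close> contains the links of the whole cycle, the closing link
    \<open>?a\<close> included.\<close>
  define C where "C = insert ?a (pairs ?d)"
  have "?e \<in> F" using assms(8) Pc by auto
  moreover have "F - {?e} = ?P" using e Pc assms(8) by auto
  ultimately have rob: "robust 2 (nbrs ?U) C"
    using fat_cycle_robust[OF assms(1) _ assms(5,6,7)] unfolding C_def Pd free by simp
  have d: "distinct ?d" "set ?d = ?J" "length ?d = Suc l" "hd ?d = hd xs" "last ?d = hd ys"
    using dist assms by (auto simp: last_rev)
  have rot: "pairs (bs @ as) \<subseteq> C" if "?d = as @ bs" for as bs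
  proof (cases "as = [] \<or> bs = []")
    case True
    then show ?thesis using that by (auto simp: C_def)
  next
    case False
    then have "hd as = hd xs" "last bs = hd ys" using that d(4,5) by auto
    moreover have "pairs as \<union> pairs bs \<subseteq> pairs ?d" using that False by (auto simp: pairs_append)
    ultimately show ?thesis using False by (auto simp: pairs_append C_def insert_commute)
  qed
  have "nbrs ?U ?a \<noteq> {}" using assms(6) free by auto
  then obtain u where u: "u \<in> nbrs ?U ?a" by auto
  then have uU: "u \<in> V" "u \<notin> ?J" by (auto simp: nbrs_def)
  have two_free: False if h: "{u, x, y} \<in> E" and y: "y \<notin> ?J" for x y
  proof -
    have xyV: "x \<in> V" "y \<in> V" and ne: "u \<noteq> x" "u \<noteq> y" "x \<noteq> y"
      using edge_subset[OF h] edge_distinct[OF h] by auto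
    show False
    proof (cases "x \<in> ?J")
      case True
      \<comment> \<open>The cycle is opened so that \<open>x\<close> is the first joint of an
        all-fat path, while \<open>u\<close> and \<open>y\<close> are free.\<close>
      then obtain as bs where ab: "?d = as @ x # bs" using d(2) by (metis split_list)
      let ?g = "x # bs @ as"
      have g: "distinct ?g" "set ?g = ?J" "length ?g = Suc l"
        using d(1-3) unfolding ab by auto
      have gC: "pairs ?g \<subseteq> C" using rot[OF ab] by simp
      have "good 2 ?g (pairs ?g) m"
        using g gC rob free
        by (intro good_reroute_joints[OF assms(1)]) (auto intro: robust_mono)
      moreover have "u \<notin> set ?g" "y \<notin> set ?g" unfolding g(2) using uU y by auto
      then have "u \<in> free ?g (pairs ?g) m" "y \<in> free ?g (pairs ?g) m"
        using uU xyV by (simp_all add: free_def core_def)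
      ultimately have "{y, u, x} \<notin> E" using no_free_edge_hd[OF _ g(3)] by fastforce
      then show False using h by (simp add: insert_commute)
    next
      case False
      have "card {x, y} \<le> 2" by (simp add: card_insert_if)
      then obtain \<nu> where \<nu>: "inj_on \<nu> C" "\<And>p. p \<in> C \<Longrightarrow> \<nu> p \<in> nbrs ?U p - {x, y}"
        using rob unfolding robust_def by (metis finite.emptyI finite.insertI)
      \<comment> \<open>Some link \<open>b\<close> of the cycle has \<open>u\<close> as its third
        vertex: if no representative is \<open>u\<close> yet, that of \<open>?a\<close> is changed
        to \<open>u\<close>.\<close>
      obtain \<mu> b where \<mu>: "inj_on \<mu> C" "\<And>p. p \<in> C \<Longrightarrow> \<mu> p \<in> nbrs ?U p - {x, y}" "b \<in> C" "\<mu> b = u"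
      proof (cases "u \<in> \<nu> ` C")
        case True then show ?thesis using \<nu> that by auto
      next
        case False
        have "inj_on (\<nu>(?a := u)) C" using \<nu>(1) False by (auto simp: inj_on_def)
        moreover have "(\<nu>(?a := u)) p \<in> nbrs ?U p - {x, y}" if "p \<in> C" for p
          using \<nu>(2)[OF that] u ne by auto
        ultimately show ?thesis using that[of "\<nu>(?a := u)" ?a] by (auto simp: C_def)
      qed
      \<comment> \<open>The cycle is opened at \<open>b\<close>, whose ends are
        \<open>last as\<close> and the first of the remaining joints; \<open>bs = []\<close> occurs
        for the closing link.\<close>
      obtain as bs where ab: "?d = as @ bs" "as \<noteq> []" "b = {last as, hd (bs @ butlast as)}"
      proof (cases "b \<in> pairs ?d")
        case True
        then show ?thesis using that by (auto elim!: pairs_split)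
      next
        case False
        then have "b = ?a" using \<mu>(3) by (simp add: C_def)
        moreover have "hd (butlast ?d) = hd xs" "last ?d = hd ys"
          using assms(3,4) d(5) by (auto simp: butlast_append hd_append)
        ultimately show ?thesis using that[of ?d "[]"] assms(3) by (auto simp: insert_commute)
      qed
      let ?r = "bs @ butlast as" and ?g = "last as"
      have rg: "?r @ [?g] = bs @ as" using ab(2) by simp
      have "distinct (?r @ [?g])" "set (?r @ [?g]) = ?J" "length (?r @ [?g]) = Suc l"
        unfolding rg using d(1-3) unfolding ab(1) by auto
      then have r: "distinct ?r" "?g \<notin> set ?r" "set ?r \<subseteq> ?J" "?g \<in> ?J" "length ?r = l"
        by auto
      have rne: "?r \<noteq> []" using r(5) l_pos by (metis list.size(3) not_one_le_zero)
      have rC: "pairs ?r \<subseteq> C"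
        using rot[OF ab(1)] rne pairs_append[OF rne, of "[?g]"] unfolding rg by auto
      have bP: "b \<notin> pairs ?r" using pairs_subset[of b ?r] r(2) ab(3) by auto
      have \<mu>U: "\<mu> p \<in> ?U - {x, y}" "insert (\<mu> p) p \<in> E" if "p \<in> C" for p
        using \<mu>(2)[OF that] by (auto simp: nbrs_def)
      have img: "\<mu> ` pairs ?r \<subseteq> ?U - {x, y}" using \<mu>U(1) rC by blast
      have 1: "expansion E ?r \<mu>"
        unfolding expansion_def
      proof (intro conjI ballI)
        show "inj_on \<mu> (pairs ?r)" using \<mu>(1) rC by (rule inj_on_subset)
        show "\<mu> ` pairs ?r \<inter> set ?r = {}" using img r(3) by auto
        show "insert (\<mu> p) p \<in> E" if "p \<in> pairs ?r" for p using \<mu>U(2) rC that by auto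
      qed (rule r(1))
      have "u \<notin> \<mu> ` pairs ?r" using \<mu>(1,3,4) bP rC by (auto simp: inj_on_def)
      moreover have "{?g, u, hd ?r} \<in> E"
        using \<mu>U(2)[OF \<mu>(3)] \<mu>(4) ab(3) by (simp add: insert_commute)
      \<comment> \<open>The edge on \<open>b\<close> and \<open>u\<close> is used differently:
        \<open>u\<close> becomes a joint and \<open>?g\<close> the third vertex, so
        \<open>{u, x, y}\<close> can be attached at \<open>u\<close>. Together with the
        \<open>l - 1\<close> edges along \<open>?r\<close> this makes \<open>l + 1\<close>.\<close>
      ultimately have 2: "expansion E (u # ?r) (\<mu>({u, hd ?r} := ?g))"
        using uU r img by (intro expansion_Cons[OF 1 rne]) auto
      define M where "M = (\<mu>({u, hd ?r} := ?g)) ` pairs (u # ?r)"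
      have M: "M \<subseteq> insert ?g (\<mu> ` pairs ?r)"
        unfolding M_def using rne by (auto simp: pairs_Cons)
      have "z \<notin> set (u # ?r) \<union> M" if "z \<in> {x, y}" for z
      proof -
        have "z \<notin> ?J" "z \<noteq> u" "z \<notin> \<mu> ` pairs ?r" using that False y ne img by auto
        then have "z \<notin> set (u # ?r)" "z \<notin> insert ?g (\<mu> ` pairs ?r)" using r(3,4) by auto
        then show ?thesis using M by blast
      qed
      then have "expansion E (x # u # ?r) ((\<mu>({u, hd ?r} := ?g))({x, hd (u # ?r)} := y))"
        using ne h unfolding M_def
        by (intro expansion_Cons[OF 2]) (simp_all only: list.sel insert_commute, auto)
      from no_longer[OF this] r(5) show False by simp
    qed
  qed
  have "{h \<in> E. u \<in> h} \<subseteq> insert u ` {T. T \<subseteq> ?J \<and> card T = 2}"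
  proof
    fix h assume "h \<in> {h \<in> E. u \<in> h}"
    then have h: "h \<in> E" "u \<in> h" by auto
    then have "card (h - {u}) = 2" using edge_card[OF h(1)] by simp
    then obtain x y where xy: "h - {u} = {x, y}" "x \<noteq> y" by (meson card_2_iff)
    then have "h = {u, x, y}" using h(2) by auto
    then have "x \<in> ?J" "y \<in> ?J"
      using two_free[of x y] two_free[of y x] h(1) by (auto simp: insert_commute)
    then show "h \<in> insert u ` {T. T \<subseteq> ?J \<and> card T = 2}"
      using xy \<open>h = {u, x, y}\<close> by (intro image_eqI[of _ _ "{x, y}"]) auto
  qed
  then have "degree E u \<le> card (insert u ` {T. T \<subseteq> ?J \<and> card T = 2})"
    unfolding degree_def by (intro card_mono) auto
  also have "\<dots> \<le> card {T. T \<subseteq> ?J \<and> card T = 2}" by (intro card_image_le) auto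
  also have "\<dots> = Suc l choose 2"
    using n_subsets[of ?J 2] distinct_card[OF dist] assms(2) by simp
  finally show ?thesis using that uU by blast
qed

section \<open>Counting the edges at an end of the path\<close>

text \<open>Edges at the end are sorted by how many of the other two vertices lie in the core;
  \<open>no_free_edge_hd\<close> excludes that neither does.\<close>

lemma degree_hd_le:
  assumes "good 2 c F m" "length c = Suc l"
  shows "degree E (hd c) \<le> ((card (core c F m) - 1) choose 2) +
    (\<Sum>p\<in>core c F m - {hd c}. card (nbrs (free c F m) {hd c, p}))"
proof -
  let ?a = "hd c" let ?K = "core c F m - {?a}" let ?N = "\<lambda>p. nbrs (free c F m) {?a, p}"
  let ?S = "insert ?a ` {T. T \<subseteq> ?K \<and> card T = 2}" and ?T = "\<Union>p\<in>?K. (\<lambda>u. {u, ?a, p}) ` ?N p"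
  have a: "?a \<in> core c F m" using assms(2) by (cases c) (auto simp: core_def)
  have fin: "finite (?N p)" for p using finite_subset[OF nbrs_subset] by simp
  have sub: "{h \<in> E. ?a \<in> h} \<subseteq> ?S \<union> ?T"
  proof
    fix h assume "h \<in> {h \<in> E. ?a \<in> h}"
    then have h: "h \<in> E" "?a \<in> h" by auto
    then have "card (h - {?a}) = 2" using edge_card[OF h(1)] by simp
    then obtain x y where xy: "h - {?a} = {x, y}" "x \<noteq> y" by (meson card_2_iff)
    then have hxy: "h = {?a, x, y}" "x \<noteq> ?a" "y \<noteq> ?a" using h(2) by auto
    have V: "x \<in> V" "y \<in> V" using edge_subset[OF h(1)] hxy by auto
    have T: "h \<in> ?T" if "h = {u, ?a, p}" "p \<in> ?K" "u \<in> free c F m" for u p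
      using that h(1) by (intro UN_I[of p] image_eqI[of _ _ u]) (auto simp: nbrs_def)
    consider "x \<in> ?K" "y \<in> ?K" | "x \<in> ?K" "y \<in> free c F m" | "y \<in> ?K" "x \<in> free c F m"
      | "x \<in> free c F m" "y \<in> free c F m"
      using V hxy by (auto simp: free_def)
    then show "h \<in> ?S \<union> ?T"
    proof cases
      case 1
      then have "h \<in> ?S" using hxy xy by (intro image_eqI[of _ _ "{x, y}"]) auto
      then show ?thesis by simp
    next
      case 2 then show ?thesis using T[of y x] hxy by (auto simp: insert_commute)
    next
      case 3 then show ?thesis using T[of x y] hxy by (auto simp: insert_commute)
    next
      case 4 then show ?thesis using no_free_edge_hd[OF assms, of x y] h(1) hxy
        by (simp add: insert_commute)
    qed
  qed
  have "degree E ?a \<le> card (?S \<union> ?T)"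
    unfolding degree_def using fin by (intro card_mono[OF _ sub]) auto
  also have "\<dots> \<le> card ?S + card ?T" by (rule card_Un_le)
  also have "card ?S \<le> card {T. T \<subseteq> ?K \<and> card T = 2}" by (intro card_image_le) auto
  also have "\<dots> = (card (core c F m) - 1) choose 2" using n_subsets[of ?K 2] a by simp
  also have "card ?T \<le> (\<Sum>p\<in>?K. card ((\<lambda>u. {u, ?a, p}) ` ?N p))" by (intro card_UN_le) simp
  also have "\<dots> \<le> (\<Sum>p\<in>?K. card (?N p))" using fin by (intro sum_mono card_image_le)
  finally show ?thesis by simp
qed

text \<open>The threshold is what \<open>robust_insert\<close> requires to make one more pair fat
  when \<open>f\<close> pairs are fat and the reserve is 2.\<close>

definition rich :: "'a list \<Rightarrow> 'a set set \<Rightarrow> ('a set \<Rightarrow> 'a) \<Rightarrow> 'a set" where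
  "rich c F m = {p \<in> core c F m - {hd c}. card (nbrs (free c F m) {hd c, p}) \<ge> f + 3}"

text \<open>The saving of 2 for \<open>f = 0\<close> is needed only for paths of lengths 2 and 4, where the
  bound on the minimum degree is otherwise too small by two.\<close>

lemma sum_poor_le:
  assumes "good 2 c F m" "length c = Suc l" "card F = f"
  shows "(\<Sum>p\<in>core c F m - {hd c} - rich c F m. card (nbrs (free c F m) {hd c, p}))
      + (if f = 0 then 2 else 0) \<le> (2 * l - f - card (rich c F m)) * (f + 2)"
proof -
  let ?K = "core c F m - {hd c}" and ?A = "rich c F m"
  define g where "g p = card (nbrs (free c F m) {hd c, p})" for p
  let ?B = "?K - ?A"
  have a: "hd c \<in> core c F m" using assms(2) by (cases c) (auto simp: core_def)
  have AK: "?A \<subseteq> ?K" by (auto simp: rich_def)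
  have "card ?K = 2 * l - f" using card_core(1)[OF assms(1,2)] a assms(3) by simp
  then have B: "card ?B = 2 * l - f - card ?A"
    using AK by (simp add: card_Diff_subset finite_subset[OF AK])
  have poor: "g p \<le> f + 2" if "p \<in> ?B" for p using that by (auto simp: rich_def g_def)
  have le: "sum g T \<le> card T * (f + 2)" if "T \<subseteq> ?B" for T
    using sum_bounded_above[of T g "f + 2"] poor that by auto
  show ?thesis
  proof (cases "f = 0")
    case False
    then show ?thesis using le[of ?B] B by (simp add: g_def[abs_def])
  next
    case True
    then have F: "F = {}" using assms(3) good_finite[OF assms(1)] by simp
    obtain a b cs where c: "c = a # b # cs"
      using assms(2) l_pos by (cases c rule: pairs.cases) auto
    let ?e = "{c ! 0, c ! 1}" let ?v = "m ?e"
    have c01: "c ! 0 = hd c" "c ! 1 = b" and e: "?e \<in> pairs c" using c by simp_all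
    have dist: "distinct c" and v: "?v \<notin> set c"
      using assms(1) e F by (auto simp: good_def)
    have bc: "b \<in> set c" "b \<noteq> hd c" "hd c \<in> set c" using dist c by auto
    have K: "b \<in> ?K" "?v \<in> ?K" "b \<noteq> ?v"
      using bc v e F assms(2) by (auto simp: core_def)
    \<comment> \<open>\<open>b\<close> and \<open>?v\<close> are the other two vertices of the first
      edge. By \<open>no_two_edges_hd\<close>, either one of the two sets is empty or both are the
      same singleton; each case saves 2 against the bound of 2 per vertex.\<close>
    let ?X = "nbrs (free c F m) {hd c, b}" and ?Y = "nbrs (free c F m) {hd c, ?v}"
    have fin: "finite ?X" "finite ?Y" using finite_subset[OF nbrs_subset] by simp_all
    have eq: "u = w" if "u \<in> ?X" "w \<in> ?Y" for u w
      using no_two_edges_hd[OF assms(1,2) refl, of u w] that F c01 by (auto simp: nbrs_def)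
    have zero: ?thesis if "z \<in> ?K" "g z = 0" for z
    proof -
      have z: "z \<in> ?B" using that by (auto simp: rich_def g_def)
      have "sum g ?B = sum g (?B - {z})" using z that(2) by (simp add: sum.remove[of ?B z])
      also have "\<dots> \<le> (card ?B - 1) * (f + 2)" using le[of "?B - {z}"] z by simp
      finally have "sum g ?B + 2 \<le> (card ?B - 1) * (f + 2) + 2" by simp
      also have "\<dots> = card ?B * (f + 2)"
        using z True card_gt_0_iff[of ?B] by (cases "card ?B") auto
      finally show ?thesis using True B by (simp add: g_def[abs_def])
    qed
    consider "?X = {}" | "?Y = {}" | u where "?X = {u}" "?Y = {u}" using eq by blast
    then show ?thesis
    proof cases
      case 1 then show ?thesis using zero[OF K(1)] by (simp add: g_def)
    next
      case 2 then show ?thesis using zero[OF K(2)] by (simp add: g_def)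
    next
      case 3
      then have g: "g b = 1" "g ?v = 1" by (simp_all add: g_def)
      have z: "b \<in> ?B" "?v \<in> ?B" using g K by (auto simp: rich_def g_def)
      have bv: "{b, ?v} \<subseteq> ?B" using z by auto
      have "sum g ?B = sum g (?B - {b, ?v}) + sum g {b, ?v}"
        by (rule sum.subset_diff[OF bv]) simp
      also have "sum g {b, ?v} = 2" using g K(3) by simp
      finally have "sum g ?B + 2 \<le> (card ?B - 2) * 2 + 4"
        using le[of "?B - {b, ?v}"] bv K(3) True by (simp add: card_Diff_subset)
      moreover have "card ?B \<ge> 2" using card_mono[OF _ bv] K(3) by simp
      ultimately show ?thesis using True B by (simp add: g_def[abs_def])
    qed
  qed
qed

text \<open>If only \<open>k\<close> vertices were rich, contributing at most all free vertices
  each, and the poor ones at most \<open>f + 2\<close> each, then \<open>degree_hd_le\<close> would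
  give too small a degree at the end.\<close>

lemma many_rich:
  assumes "good 2 c F m" "length c = Suc l" "card F = f"
    and room: "2 * l + 3 \<le> card V" and k: "k + f \<le> 2 * l"
    and deg: "((2 * l - f) choose 2) + k * (card V - 1 - (2 * l - f)) + (2 * l - f - k) * (f + 2)
      < degree E (hd c) + (if f = 0 then 2 else 0)"
  shows "k < card (rich c F m)"
proof (rule ccontr)
  let ?K = "core c F m - {hd c}" and ?A = "rich c F m" and ?U = "free c F m"
  let ?g = "\<lambda>p. card (nbrs ?U {hd c, p})"
  assume "\<not> k < card ?A"
  then obtain d where d: "k = card ?A + d" by (metis le_Suc_ex not_less)
  have AK: "?A \<subseteq> ?K" by (auto simp: rich_def)
  have cK: "card (core c F m) = Suc (2 * l - f)"
    using card_core[OF assms(1,2)] assms(3) by simp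
  have cU: "card ?U = card V - 1 - (2 * l - f)"
    using card_Diff_subset[OF _ core_subset[OF assms(1)]] cK by (simp add: free_def)
  \<comment> \<open>Because of this, counting \<open>d\<close> poor vertices as if they were rich
    only raises the bound.\<close>
  have U: "f + 2 \<le> card ?U" using card_core(2)[OF assms(1,2)] assms(3) room cU by simp
  have "sum ?g ?K = sum ?g (?K - ?A) + sum ?g ?A"
    by (rule sum.subset_diff[OF AK]) simp
  moreover have "sum ?g ?A \<le> card ?A * card ?U"
    using sum_bounded_above[of ?A ?g "card ?U"] by (auto intro: card_mono[OF finite_free nbrs_subset])
  moreover note sum_poor_le[OF assms(1-3)]
  moreover have "(2 * l - f - card ?A) * (f + 2) = (2 * l - f - k) * (f + 2) + d * (f + 2)"
  proof -
    have "2 * l - f - card ?A = (2 * l - f - k) + d" using d k by simp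
    then show ?thesis by (simp add: algebra_simps)
  qed
  moreover have "d * (f + 2) \<le> d * card ?U" using U by (rule mult_le_mono2)
  moreover have "k * card ?U = card ?A * card ?U + d * card ?U" using d by (simp add: algebra_simps)
  ultimately have "sum ?g ?K + (if f = 0 then 2 else 0) \<le> k * card ?U + (2 * l - f - k) * (f + 2)"
    by linarith
  then show False using degree_hd_le[OF assms(1,2)] deg cK cU by simp
qed

section \<open>Contradiction from two rich ends\<close>

text \<open>Pigeonhole over the \<open>l\<close> edges: each edge is charged with at most one rich
  vertex per end, so some edge is charged from both ends. Then \<open>nonfat_meeting\<close> or the
  two lemmas on the fat cycle apply.\<close>

lemma too_rich:
  assumes "good 2 c F m" "length c = Suc l" "card F = f"
    and "l < card (rich c F m) + card (rich (rev c) F m)"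
    and deg: "\<And>v. v \<in> V \<Longrightarrow> Suc l choose 2 < degree E v"
  shows False
proof -
  define e where "e i = {c ! i, c ! Suc i}" for i
  \<comment> \<open>\<open>s i\<close> and \<open>t i\<close> are the vertices of edge
    \<open>i\<close> charged for the first and the last joint: the third vertex if the edge is not
    fat, otherwise its joint farther from the respective end.\<close>
  define s where "s i = (if e i \<in> F then c ! Suc i else m (e i))" for i
  define t where "t i = (if e i \<in> F then c ! i else m (e i))" for i
  let ?U = "free c F m"
  have c: "c \<noteq> []" and hd: "hd c = c ! 0" and last: "hd (rev c) = c ! l"
    using assms(2) hd_conv_nth[of c] last_conv_nth[of c] by (cases "c = []"; simp add: hd_rev)+
  have P: "\<exists>i<l. p = e i" if "p \<in> pairs c" for p
    using that assms(2) by (auto simp: pairs_nth e_def)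
  have split: "c = take (Suc i) c @ drop (Suc i) c" "take (Suc i) c \<noteq> []" "drop (Suc i) c \<noteq> []"
      "hd (take (Suc i) c) = c ! 0" "last (take (Suc i) c) = c ! i"
      "hd (drop (Suc i) c) = c ! Suc i" "last (drop (Suc i) c) = c ! l" if "i < l" for i
  proof -
    have i: "i < length c" "Suc i < length c" using that assms(2) by auto
    show "take (Suc i) c \<noteq> []" "drop (Suc i) c \<noteq> []" using i c by auto
    show "hd (take (Suc i) c) = c ! 0" using hd by simp
    show "last (take (Suc i) c) = c ! i" using i by (simp add: take_Suc_conv_app_nth)
    show "hd (drop (Suc i) c) = c ! Suc i" using i by (simp add: hd_drop_conv_nth)
    show "last (drop (Suc i) c) = c ! l" using i assms(2) c by (simp add: last_conv_nth)
  qed simp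
  have joint: "e i \<in> F" if "i < l" "c ! Suc i \<in> rich c F m" for i
  proof (rule ccontr)
    assume "e i \<notin> F"
    let ?x = "take (Suc i) c" and ?y = "drop (Suc i) c"
    have "card (nbrs (free (?x @ ?y) F m) {hd ?x, hd ?y}) < f + 3"
      using split[OF that(1)] assms(1-3) \<open>e i \<notin> F\<close>
      by (intro nonfat_joint) (simp_all add: e_def)
    then show False using that(2) split[OF that(1)] hd by (simp add: rich_def)
  qed
  \<comment> \<open>The same rotation on the reversed path, where \<open>c ! i\<close> takes over
    the role of \<open>c ! Suc i\<close>.\<close>
  have joint': "e i \<in> F" if "i < l" "c ! i \<in> rich (rev c) F m" for i
  proof (rule ccontr)
    assume "e i \<notin> F"
    let ?x = "rev (drop (Suc i) c)" and ?y = "rev (take (Suc i) c)"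
    have rc: "?x @ ?y = rev c" using split(1)[OF that(1)] by (metis rev_append)
    have "card (nbrs (free (?x @ ?y) F m) {hd ?x, hd ?y}) < f + 3"
    proof (rule nonfat_joint)
      show "good 2 (?x @ ?y) F m" unfolding rc by (rule good_rev[OF assms(1)])
      show "length (?x @ ?y) = Suc l" unfolding rc using assms(2) by simp
      show "{last ?x, hd ?y} \<notin> F"
        using \<open>e i \<notin> F\<close> split[OF that(1)] by (simp add: e_def last_rev hd_rev insert_commute)
    qed (use split[OF that(1)] assms(3) in auto)
    then show False
      using that(2) split[OF that(1)] last unfolding rc by (simp add: rich_def hd_rev)
  qed
  have "rich c F m \<subseteq> s ` {i. i < l \<and> s i \<in> rich c F m}"
  proof
    fix p assume p: "p \<in> rich c F m"
    then consider "p \<in> set c" "p \<noteq> c ! 0" | q where "q \<in> pairs c - F" "p = m q"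
      using hd by (auto simp: rich_def core_def)
    then show "p \<in> s ` {i. i < l \<and> s i \<in> rich c F m}"
    proof cases
      case 1
      then obtain j where "p = c ! j" "j < Suc l" using assms(2) by (auto simp: in_set_conv_nth)
      then obtain i where "p = c ! Suc i" "i < l" using 1(2) by (cases j) auto
      then show ?thesis using joint[of i] p by (intro image_eqI[of _ _ i]) (auto simp: s_def)
    next
      case 2
      then obtain i where "i < l" "q = e i" using P by auto
      then show ?thesis using 2 p by (intro image_eqI[of _ _ i]) (auto simp: s_def)
    qed
  qed
  then have 1: "card (rich c F m) \<le> card {i. i < l \<and> s i \<in> rich c F m}" by (rule surj_card_le[rotated]) simp
  have "rich (rev c) F m \<subseteq> t ` {i. i < l \<and> t i \<in> rich (rev c) F m}"
  proof
    fix p assume p: "p \<in> rich (rev c) F m"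
    then consider "p \<in> set c" "p \<noteq> c ! l" | q where "q \<in> pairs c - F" "p = m q"
      using last by (auto simp: rich_def core_def)
    then show "p \<in> t ` {i. i < l \<and> t i \<in> rich (rev c) F m}"
    proof cases
      case 1
      then obtain i where "p = c ! i" "i < Suc l" using assms(2) by (auto simp: in_set_conv_nth)
      moreover from this have "i < l" using 1(2) by (cases "i = l") auto
      ultimately show ?thesis using joint'[of i] p by (intro image_eqI[of _ _ i]) (auto simp: t_def)
    next
      case 2
      then obtain i where "i < l" "q = e i" using P by auto
      then show ?thesis using 2 p by (intro image_eqI[of _ _ i]) (auto simp: t_def)
    qed
  qed
  then have 2: "card (rich (rev c) F m) \<le> card {i. i < l \<and> t i \<in> rich (rev c) F m}"
    by (rule surj_card_le[rotated]) simp
  let ?I = "{i. i < l \<and> s i \<in> rich c F m}" and ?J = "{i. i < l \<and> t i \<in> rich (rev c) F m}"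
  have "?I \<inter> ?J \<noteq> {}"
  proof
    assume "?I \<inter> ?J = {}"
    then have "card ?I + card ?J = card (?I \<union> ?J)" by (simp add: card_Un_disjoint)
    also have "\<dots> \<le> card {..<l}" by (intro card_mono) auto
    finally show False using 1 2 assms(4) by simp
  qed
  then obtain i where i: "i < l" "s i \<in> rich c F m" "t i \<in> rich (rev c) F m" by auto
  let ?x = "take (Suc i) c" and ?y = "drop (Suc i) c"
  have xy: "?x @ ?y = c" by simp
  have N: "f + 3 \<le> card (nbrs ?U {c ! 0, s i})" "f + 3 \<le> card (nbrs ?U {c ! l, t i})"
    using i hd last by (auto simp: rich_def)
  show False
  proof (cases "e i \<in> F")
    case False
    show False
      using nonfat_meeting[of ?x ?y F m "m (e i)"] split(2-)[OF i(1)] assms(1-3) N False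
      by (simp add: s_def t_def e_def)
  next
    case True
    have "F = pairs (?x @ ?y)"
      using fat_cycle_all_fat[of ?x ?y F m] split(2-)[OF i(1)] assms(1-3) N True
      by (simp add: s_def t_def e_def)
    then obtain u where "u \<in> V" "degree E u \<le> Suc l choose 2"
      using fat_cycle_small_degree[of ?x ?y F m] split(2-)[OF i(1)] assms(1-3) N True
      by (auto simp: s_def t_def e_def)
    then show False using deg[of u] by simp
  qed
qed

end

section \<open>Extending a path by one edge\<close>

lemma pairs_cover: "length xs \<ge> 2 \<Longrightarrow> set xs \<subseteq> \<Union> (pairs xs)"
proof (induction xs rule: pairs.induct)
  case (1 x y zs)
  then show ?case by (cases zs) auto
qed auto

text \<open>If no longer path existed, \<open>saturated\<close> would hold with \<open>f\<close> the
  largest number of fat pairs on a good path of length \<open>l\<close>. As this \<open>f\<close> is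
  unknown, \<open>deg\<close> is assumed for all \<open>f \<le> l\<close>.\<close>

lemma expansion_extend:
  assumes tg: "three_graph V E" and l: "l \<ge> 1"
    and exp: "expansion E c m" "length c = Suc l"
    and D: "\<And>v. v \<in> V \<Longrightarrow> D \<le> degree E v"
    and k: "k \<le> l" "l < 2 * k + 2"
    and room: "2 * l + 3 \<le> card V"
    and deg: "\<And>f. f \<le> l \<Longrightarrow> ((2 * l - f) choose 2) + k * (card V - 1 - (2 * l - f)) +
      (2 * l - f - k) * (f + 2) < D + (if f = 0 then 2 else 0)"
    and small: "Suc l choose 2 < D"
  obtains c' m' where "expansion E c' m'" "length c' = Suc (Suc l)"
proof (rule ccontr)
  assume "\<not> thesis"
  then have no: "length c \<noteq> Suc (Suc l)" if "expansion E c m" for c m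
    using that \<open>\<And>c' m'. expansion E c' m' \<Longrightarrow> length c' = Suc (Suc l) \<Longrightarrow> thesis\<close> by blast
  interpret hypergraph3 V E by unfold_locales (rule tg)
  \<comment> \<open>\<open>expansion\<close> does not mention \<open>V\<close>; the joints lie in
    \<open>V\<close> because each is in some edge, as \<open>l \<ge> 1\<close>.\<close>
  have "set c \<subseteq> \<Union> (pairs c)" using pairs_cover[of c] exp(2) l by simp
  moreover have "p \<subseteq> V" if "p \<in> pairs c" for p
    using exp(1) that edge_subset[of "insert (m p) p"] by (simp add: expansion_def)
  ultimately have "set c \<subseteq> V" by blast
  then have c0: "good 2 c {} m" using exp(1) good_empty by simp
  define Q where "Q f \<longleftrightarrow> (\<exists>c F m. good 2 c F m \<and> length c = Suc l \<and> card F = f)" for f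
  have bound: "f \<le> l" if "Q f" for f using that card_core(2) by (auto simp: Q_def)
  have "Q 0" unfolding Q_def using c0 exp(2) by (intro exI[of _ c] exI[of _ "{}"] exI[of _ m]) simp
  then obtain f where f: "Q f" "\<And>f'. Q f' \<Longrightarrow> f' \<le> f"
    using GreatestI_nat[of Q 0 l] Greatest_le_nat[of Q _ l] bound by blast
  interpret saturated V E l f
  proof
    show "length c \<noteq> Suc (Suc l)" if "expansion E c m" for c m using no that .
    show "card F \<le> f" if "good 2 c F m" "length c = Suc l" for c F m
      using f(2) that by (auto simp: Q_def)
  qed (rule l)
  obtain c F m where c: "good 2 c F m" "length c = Suc l" "card F = f"
    using f(1) by (auto simp: Q_def)
  have fl: "f \<le> l" using bound f(1) by simp
  have rich: "k < card (rich d F m)" if "good 2 d F m" "length d = Suc l" for d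
  proof (rule many_rich[OF that c(3) room])
    show "k + f \<le> 2 * l" using fl k(1) by simp
    have "hd d \<in> V" using that by (cases d) (auto simp: good_def)
    then have "D \<le> degree E (hd d)" by (rule D)
    then show "((2 * l - f) choose 2) + k * (card V - 1 - (2 * l - f)) + (2 * l - f - k) * (f + 2)
        < degree E (hd d) + (if f = 0 then 2 else 0)"
      using deg[OF fl] by linarith
  qed
  \<comment> \<open>Each end has at least \<open>k + 1\<close> rich vertices, and
    \<open>2 * k + 2\<close> exceeds \<open>l\<close>.\<close>
  have "l < card (rich c F m) + card (rich (rev c) F m)"
    using rich[OF c(1,2)] rich[OF good_rev[OF c(1)]] c(2) k(2) by simp
  then show False using too_rich[OF c] D small by (meson less_le_trans)
qed

section \<open>Arithmetic of the degree bounds\<close>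

lemma min_degree_le: "finite V \<Longrightarrow> v \<in> V \<Longrightarrow> min_degree V E \<le> degree E v"
  by (simp add: min_degree_def)

lemma int_choose_two: "2 * int (n choose 2) = int n * (int n - 1)"
  by (induction n) (auto simp: numeral_2_eq_2 algebra_simps)

text \<open>The case \<open>l = 2 * k\<close>. After doubling, and with \<open>D\<close> at its
  lower bound, the sides differ by the quantity in \<open>pos\<close>; for \<open>f = 0\<close> and
  \<open>k\<close> equal to 1 or 2 it is positive only through its last term.\<close>

lemma odd_bound:
  assumes "k \<ge> 1" "4 * k + 19 \<le> n" "f \<le> 2 * k"
    and D: "int k * int n + 6 * (int k)^2 - 3 * int k + 3 \<le> int D"
  shows "((2 * (2 * k) - f) choose 2) + k * (n - 1 - (2 * (2 * k) - f)) +
    (2 * (2 * k) - f - k) * (f + 2) < D + (if f = 0 then 2 else 0)"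
proof -
  define q r t where "q = 2 * (2 * k) - f" and "r = n - 1 - q" and "t = q - k"
  \<comment> \<open>The bounds on \<open>n\<close> and \<open>f\<close> make the truncated
    subtractions exact.\<close>
  have q: "int q = 4 * int k - int f" and r: "int r = int n - 1 - (4 * int k - int f)"
    and t: "int t = 3 * int k - int f"
    using assms by (auto simp: q_def r_def t_def)
  have pos: "0 < 4 * int k * int k - 12 * int k + 6 + 3 * int f + int f * int f
      + (if f = 0 then 4 else 0)"
  proof (cases "k \<ge> 3")
    case True
    then have "0 \<le> 4 * int k * (int k - 3)" by simp
    moreover have "4 * int k * (int k - 3) = 4 * int k * int k - 12 * int k"
      by (simp add: algebra_simps)
    moreover have "0 \<le> int f * int f" "0 \<le> (if f = 0 then 4 else 0 :: int)" by simp_all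
    ultimately show ?thesis by linarith
  next
    case False
    then have "k = 1 \<or> k = 2" using assms(1) by auto
    moreover have "0 < 3 * int f - 2 + int f * int f" if "f \<noteq> 0"
      using that zero_le_square[of "int f"] by linarith
    ultimately show ?thesis by (cases "f = 0") auto
  qed
  have "int q * (int q - 1) + 2 * (int k * int r) + 2 * (int t * (int f + 2))
      < 2 * (int k * int n + 6 * (int k)^2 - 3 * int k + 3) + (if f = 0 then 4 else 0)"
    unfolding q r t using pos by (cases "f = 0") (simp_all add: algebra_simps power2_eq_square)
  then have "2 * int ((q choose 2) + k * r + t * (f + 2)) < 2 * int (D + (if f = 0 then 2 else 0))"
    using D unfolding of_nat_add of_nat_mult distrib_left int_choose_two by auto
  then have "(q choose 2) + k * r + t * (f + 2) < D + (if f = 0 then 2 else 0)"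
    by (simp only: mult_less_cancel_left_pos zero_less_numeral of_nat_less_iff)
  then show ?thesis unfolding t_def r_def q_def .
qed

text \<open>The case \<open>l = 2 * k + 1\<close>. The difference of the doubled sides is at least
  \<open>4 * k * (k - 1) + 3 * f + f^2 + 2\<close>, which is positive.\<close>

lemma even_bound:
  assumes "4 * k + 21 \<le> n" "f \<le> 2 * k + 1"
    and D: "int k * int n + 6 * (int k)^2 + 7 * int k + 6 \<le> int D"
  shows "((2 * (2 * k + 1) - f) choose 2) + k * (n - 1 - (2 * (2 * k + 1) - f)) +
    (2 * (2 * k + 1) - f - k) * (f + 2) < D + (if f = 0 then 2 else 0)"
proof -
  define q r t where "q = 2 * (2 * k + 1) - f" and "r = n - 1 - q" and "t = q - k"
  have q: "int q = 4 * int k + 2 - int f" and r: "int r = int n - 1 - (4 * int k + 2 - int f)"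
    and t: "int t = 3 * int k + 2 - int f"
    using assms by (auto simp: q_def r_def t_def)
  have "0 \<le> 4 * int k * (int k - 1) + 3 * int f + int f * int f" by (cases k) auto
  then have "int q * (int q - 1) + 2 * (int k * int r) + 2 * (int t * (int f + 2))
      < 2 * (int k * int n + 6 * (int k)^2 + 7 * int k + 6)"
    unfolding q r t by (simp add: algebra_simps power2_eq_square)
  then have "2 * int ((q choose 2) + k * r + t * (f + 2)) < 2 * int D"
    using D unfolding of_nat_add of_nat_mult distrib_left int_choose_two by auto
  then have "(q choose 2) + k * r + t * (f + 2) < D"
    by (simp only: mult_less_cancel_left_pos zero_less_numeral of_nat_less_iff)
  then show ?thesis unfolding t_def r_def q_def by (rule trans_less_add1)
qed

section \<open>Induction on the path length\<close>

definition longpath :: "'a set set \<Rightarrow> nat \<Rightarrow> bool" where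
  "longpath E l \<longleftrightarrow> (\<exists>c m. expansion E c m \<and> length c = Suc l)"

lemma longpath_odd:
  assumes "three_graph V E" "4 * k + 19 \<le> card V" "k \<ge> 1" "longpath E (2 * k)"
    and deg: "int k * int (card V) + 6 * (int k)^2 - 3 * int k + 3 \<le> int (min_degree V E)"
  shows "longpath E (2 * k + 1)"
proof -
  have D: "min_degree V E \<le> degree E v" if "v \<in> V" for v
    using min_degree_le that assms(1) by (auto simp: three_graph_def)
  obtain c m where c: "expansion E c m" "length c = Suc (2 * k)"
    using assms(4) by (auto simp: longpath_def)
  have "3 * int k \<le> int k * int (card V)"
    using assms(2) by (subst mult.commute, intro mult_left_mono) auto
  moreover have "int k \<le> int k * int k" using assms(3) by simp
  ultimately have "2 * int (Suc (2 * k) choose 2) < 2 * int (min_degree V E)"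
    using deg unfolding int_choose_two by (simp add: algebra_simps power2_eq_square)
  then have small: "Suc (2 * k) choose 2 < min_degree V E" by simp
  obtain c' m' where "expansion E c' m'" "length c' = Suc (Suc (2 * k))"
  proof (rule expansion_extend[OF assms(1) _ c D, of k])
    show "((2 * (2 * k) - f) choose 2) + k * (card V - 1 - (2 * (2 * k) - f)) +
        (2 * (2 * k) - f - k) * (f + 2) < min_degree V E + (if f = 0 then 2 else 0)"
      if "f \<le> 2 * k" for f
      using odd_bound[OF assms(3,2) that deg] .
  qed (use assms(2,3) small in auto)
  then show ?thesis by (auto simp: longpath_def)
qed

lemma longpath_even:
  assumes "three_graph V E" "4 * k + 21 \<le> card V" "longpath E (2 * k + 1)"
    and deg: "int k * int (card V) + 6 * (int k)^2 + 7 * int k + 6 \<le> int (min_degree V E)"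
  shows "longpath E (2 * k + 2)"
proof -
  have D: "min_degree V E \<le> degree E v" if "v \<in> V" for v
    using min_degree_le that assms(1) by (auto simp: three_graph_def)
  obtain c m where c: "expansion E c m" "length c = Suc (2 * k + 1)"
    using assms(3) by (auto simp: longpath_def)
  have "2 * int (Suc (2 * k + 1) choose 2) = 4 * (int k)^2 + 6 * int k + 2"
    unfolding int_choose_two by (simp add: algebra_simps power2_eq_square)
  moreover have "0 \<le> int k * int (card V)" "0 \<le> (int k)^2" by simp_all
  ultimately have "2 * int (Suc (2 * k + 1) choose 2) < 2 * int (min_degree V E)"
    using deg by linarith
  then have small: "Suc (2 * k + 1) choose 2 < min_degree V E" by simp
  obtain c' m' where "expansion E c' m'" "length c' = Suc (Suc (2 * k + 1))"
  proof (rule expansion_extend[OF assms(1) _ c D, of k])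
    show "((2 * (2 * k + 1) - f) choose 2) + k * (card V - 1 - (2 * (2 * k + 1) - f)) +
        (2 * (2 * k + 1) - f - k) * (f + 2) < min_degree V E + (if f = 0 then 2 else 0)"
      if "f \<le> 2 * k + 1" for f
      using even_bound[OF assms(2) that deg] .
  qed (use assms(2) small in auto)
  then show ?thesis by (auto simp: longpath_def)
qed

lemma longpath_1:
  assumes "three_graph V E" "V \<noteq> {}" "0 < min_degree V E"
  shows "longpath E 1"
proof -
  have fin: "finite V" using assms by (simp add: three_graph_def)
  obtain v where "v \<in> V" using assms(2) by auto
  then have "0 < degree E v" using min_degree_le[OF fin, of v E] assms(3) by simp
  then obtain h where h: "h \<in> E" by (fastforce simp: degree_def card_gt_0_iff)
  then have "card h = 3" using assms(1) by (simp add: three_graph_def)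
  then obtain x y z where "h = {x, y, z}" "x \<noteq> y" "y \<noteq> z" "x \<noteq> z" by (auto simp: card_3_iff)
  then have "expansion E [x, y] (\<lambda>_. z)" using h by (auto simp: expansion_def insert_commute)
  then show ?thesis unfolding longpath_def by (intro exI[of _ "[x, y]"]) auto
qed

text \<open>Starting from a single edge, each length is reached from the previous one: even after
  odd for the same \<open>k\<close>, then odd for \<open>Suc k\<close>.\<close>

lemma longpath_exists:
  assumes "three_graph V E"
  shows "(4 * k + 19 \<le> card V \<longrightarrow>
      int k * int (card V) + 6 * (int k)^2 - 3 * int k + 3 \<le> int (min_degree V E) \<longrightarrow>
      longpath E (2 * k + 1)) \<and>
    (4 * k + 21 \<le> card V \<longrightarrow>
      int k * int (card V) + 6 * (int k)^2 + 7 * int k + 6 \<le> int (min_degree V E) \<longrightarrow>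
      longpath E (2 * k + 2))"
proof (induction k)
  case 0
  show ?case
    using longpath_1[OF assms] longpath_even[OF assms, of 0] by (cases "V = {}") auto
next
  case (Suc k)
  let ?n = "int (card V)" and ?d = "int (min_degree V E)"
  have odd: "longpath E (2 * Suc k + 1)" if n: "4 * Suc k + 19 \<le> card V"
    and d: "int (Suc k) * ?n + 6 * (int (Suc k))^2 - 3 * int (Suc k) + 3 \<le> ?d"
  proof -
    \<comment> \<open>The odd bound for \<open>Suc k\<close> exceeds the even bound for
      \<open>k\<close> by \<open>?n + 2 * k\<close>, so the induction hypothesis supplies the path
      of length \<open>2 * Suc k\<close>.\<close>
    have "int k * ?n + 6 * (int k)^2 + 7 * int k + 6 \<le> ?d"
      using n d by (simp add: algebra_simps power2_eq_square)
    then have "longpath E (2 * Suc k)" using Suc n by simp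
    then show ?thesis using longpath_odd[OF assms n _ _ d] by simp
  qed
  moreover have "longpath E (2 * Suc k + 2)" if n: "4 * Suc k + 21 \<le> card V"
    and d: "int (Suc k) * ?n + 6 * (int (Suc k))^2 + 7 * int (Suc k) + 6 \<le> ?d"
    using longpath_even[OF assms n _ d] odd n d by simp
  ultimately show ?case by blast
qed

lemma longpath_contains: "longpath E l \<Longrightarrow> contains_linear_path E l"
  using expansion_linear_path by (auto simp: longpath_def)

theorem theorem1p2:
  fixes k :: nat
  shows "(\<forall>(V :: 'a set) E n.
            three_graph V E \<and> card V = n \<and> n \<ge> 4 * k + 19 \<and>
            int (min_degree V E) \<ge> int k * int n + 6 * (int k)^2 - 3 * int k + 3
            \<longrightarrow> contains_linear_path E (2 * k + 1))
       \<and> (\<forall>(V :: 'a set) E n.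
            three_graph V E \<and> card V = n \<and> n \<ge> 4 * k + 21 \<and>
            int (min_degree V E) \<ge> int k * int n + 6 * (int k)^2 + 7 * int k + 6
            \<longrightarrow> contains_linear_path E (2 * k + 2))"
  using longpath_exists longpath_contains by blast

end
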